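(* Let $n,k\ge1$ and let $\bm c,\bm c_1,\dots,\bm c_k\in\mathbb R^{2^n}$. The following two conditions are equivalent: (i) for all $\bm h\in\overline{\Gamma}_n^*$: $\ \bigwedge_{i\in[k]}(\bm c_i\cdot\bm h\ge0)\ \Rightarrow\ \bm c\cdot\bm h\ge0$; (ii) for every $\varepsilon>0$ there exist $\lambda_1\ge0,\dots,\lambda_k\ge0$ such that for all $\bm h\in\overline{\Gamma}_n^*$: $\ \bm c\cdot\bm h+\varepsilon\,h([n])\ \ge\ \sum_{i\in[k]}\lambda_i\,\bm c_i\cdot\bm h$. Moreover, if the set $\{\bm c_1,\dots,\bm c_k\}$ has slack, then one can set $\varepsilon=0$ in (ii); that is, (i) is then equivalent to the existence of $\lambda_1,\dots,\lambda_k\ge0$ such that $\bm c\cdot\bm h\ge\sum_{i\in[k]}\lambda_i\,\bm c_i\cdot\bm h$ for all $\bm h\in\overline{\Gamma}_n^*$.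
   Context: All logarithms are in base 2. A random variable $X$ with finite domain $D$ and probability mass function $p$ has entropy $H(X)=-\sum_{x\in D}p(x)\log p(x)$. Given a joint distribution of $n$ random variables $X_1,\dots,X_n$ with finite domains, its entropic vector is $\bm h=(h(\alpha))_{\alpha\subseteq[n]}\in\mathbb R_+^{2^n}$, where $h(\alpha)=H((X_i)_{i\in\alpha})$ and $h(\emptyset)=0$. $\Gamma_n^*$ denotes the set of all entropic vectors and $\overline{\Gamma}_n^*$ its topological closure, the set of almost-entropic vectors. For $\bm c,\bm h\in\mathbb R^{2^n}$, $\bm c\cdot\bm h=\sum_{\alpha\subseteq[n]}c_\alpha h(\alpha)$. The set $\{\bm c_1,\dots,\bm c_k\}\subset\mathbb R^{2^n}$ has slack if there exists a single $\bm h\in\overline{\Gamma}_n^*$ such that $\bm c_i\cdot\bm h>0$ for all $i=1,\dots,k$. *)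

theory Defs
  imports "HOL-Probability.Probability"
begin

definition shannon_entropy :: "'a pmf \<Rightarrow> real" where
  "shannon_entropy p = - (\<Sum>x\<in>set_pmf p. pmf p x * log 2 (pmf p x))"

lemma shannon_entropy_superset:
  assumes "finite D" "set_pmf p \<subseteq> D"
  shows "shannon_entropy p = - (\<Sum>x\<in>D. pmf p x * log 2 (pmf p x))"
proof -
  have "(\<Sum>x\<in>set_pmf p. pmf p x * log 2 (pmf p x)) = (\<Sum>x\<in>D. pmf p x * log 2 (pmf p x))"
    by (rule sum.mono_neutral_left) (use assms in \<open>auto simp: pmf_eq_0_set_pmf\<close>)
  then show ?thesis
    by (simp add: shannon_entropy_def)
qed

lemma shannon_entropy_eq_entropy:
  fixes p :: "'a pmf" and X :: "'a \<Rightarrow> 'b::countable"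
  assumes "finite (set_pmf p)"
  shows "shannon_entropy (map_pmf X p) = prob_space.entropy (measure_pmf p) 2 (count_space UNIV) X"
proof -
  let ?q = "map_pmf X p"
  have "distr (measure_pmf p) (count_space UNIV) X = density (count_space UNIV) (pmf ?q)"
    using measure_pmf_eq_density[of ?q] by (simp add: map_pmf_rep_eq)
  moreover have "KL_divergence 2 (count_space UNIV) (density (count_space UNIV) (pmf ?q)) =
      (\<integral>x. pmf ?q x * log 2 (pmf ?q x) \<partial>count_space UNIV)"
    by (rule sigma_finite_measure.KL_density)
      (auto intro: sigma_finite_measure_count_space_countable)
  moreover have "\<dots> = (\<Sum>x\<in>set_pmf ?q. pmf ?q x * log 2 (pmf ?q x))"
  proof -
    have sub: "{x. pmf ?q x * log 2 (pmf ?q x) \<noteq> 0} \<subseteq> set_pmf ?q"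
      unfolding set_pmf_eq by (auto simp del: pmf_eq_0_set_pmf)
    then have "finite {x. pmf ?q x * log 2 (pmf ?q x) \<noteq> 0}"
      by (rule finite_subset) (use assms in simp)
    then have "(\<integral>x. pmf ?q x * log 2 (pmf ?q x) \<partial>count_space UNIV) =
        (\<Sum>x | pmf ?q x * log 2 (pmf ?q x) \<noteq> 0. pmf ?q x * log 2 (pmf ?q x))"
      by (subst lebesgue_integral_count_space_finite_support) simp_all
    also have "\<dots> = (\<Sum>x\<in>set_pmf ?q. pmf ?q x * log 2 (pmf ?q x))"
      by (rule sum.mono_neutral_left) (use assms sub in auto)
    finally show ?thesis .
  qed
  ultimately show ?thesis
    by (simp add: shannon_entropy_def prob_space.entropy_def[OF measure_pmf.prob_space_axioms])
qed

lemma shannon_entropy_map_inj: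
  assumes "inj_on f (set_pmf p)"
  shows "shannon_entropy (map_pmf f p) = shannon_entropy p"
  using assms by (simp add: shannon_entropy_def sum.reindex pmf_map_inj)

text \<open>
  A joint distribution of \<open>(X\<^sub>i)\<close>, \<open>i :: 'n\<close>, is the pmf of the tuple \<open>\<lambda>i. X\<^sub>i\<close>; the map
  \<open>\<lambda>x. restrict x \<alpha>\<close> sends it to the distribution of the subtuple \<open>(X\<^sub>i)\<^sub>i\<^sub>\<in>\<^sub>\<alpha>\<close>.
  The index type \<open>'n\<close> plays the role of \<open>[n]\<close>, and vectors with one component for each
  \<open>\<alpha> \<subseteq> [n]\<close> are elements of \<open>real ^ ('n set)\<close>.
\<close>

definition entropic_vector :: "('n::finite \<Rightarrow> 'a) pmf \<Rightarrow> real ^ ('n set)" where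
  "entropic_vector p = (\<chi> \<alpha>. shannon_entropy (map_pmf (\<lambda>x. restrict x \<alpha>) p))"

text \<open>
  Since the index type is finite, the joint support is finite iff every \<open>X\<^sub>i\<close> takes finitely many
  values. The alphabet \<open>nat\<close> is no restriction, see \<open>entropic_vector_in_entropic_vectors\<close>.
\<close>

definition entropic_vectors :: "(real ^ ('n::finite set)) set" where
  "entropic_vectors = {entropic_vector p | p :: ('n \<Rightarrow> nat) pmf. finite (set_pmf p)}"

lemma entropic_vector_empty: "entropic_vector p $ {} = 0"
proof -
  have "map_pmf (\<lambda>x. restrict x {}) p = return_pmf (\<lambda>_. undefined)"
    by (simp add: restrict_def)
  then show ?thesis
    by (simp add: entropic_vector_def shannon_entropy_def del: set_map_pmf)
qed

lemma entropic_vector_in_entropic_vectors: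
  fixes p :: "('n::finite \<Rightarrow> 'a) pmf"
  assumes "finite (set_pmf p)"
  shows "entropic_vector p \<in> entropic_vectors"
proof -
  define D where "D = (\<Union>x\<in>set_pmf p. range x)"
  have "finite D"
    unfolding D_def using assms by auto
  then obtain f :: "'a \<Rightarrow> nat" where f: "inj_on f D"
    using finite_imp_inj_to_nat_seg by blast
  have D: "x i \<in> D" if "x \<in> set_pmf p" for x i
    using that by (auto simp: D_def)
  define q where "q = map_pmf (\<lambda>x. f \<circ> x) p"
  have "shannon_entropy (map_pmf (\<lambda>x. restrict x \<alpha>) q) = shannon_entropy (map_pmf (\<lambda>x. restrict x \<alpha>) p)"
    for \<alpha> :: "'n set"
  proof -
    define g :: "('n \<Rightarrow> 'a) \<Rightarrow> 'n \<Rightarrow> nat" where "g = (\<lambda>y. restrict (f \<circ> y) \<alpha>)"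
    have "inj_on g (set_pmf (map_pmf (\<lambda>x. restrict x \<alpha>) p))"
    proof (rule inj_onI)
      fix y z
      assume yz: "y \<in> set_pmf (map_pmf (\<lambda>x. restrict x \<alpha>) p)"
        "z \<in> set_pmf (map_pmf (\<lambda>x. restrict x \<alpha>) p)" and eq: "g y = g z"
      show "y = z"
      proof
        fix i
        show "y i = z i"
        proof (cases "i \<in> \<alpha>")
          case True
          then have "f (y i) = f (z i)"
            using fun_cong[OF eq, of i] by (simp add: g_def)
          moreover have "y i \<in> D" "z i \<in> D"
            using yz True by (auto intro: D)
          ultimately show ?thesis
            using f by (auto dest: inj_onD)
        qed (use yz in auto)
      qed
    qed
    then have "shannon_entropy (map_pmf g (map_pmf (\<lambda>x. restrict x \<alpha>) p)) =
        shannon_entropy (map_pmf (\<lambda>x. restrict x \<alpha>) p)"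
      by (rule shannon_entropy_map_inj)
    moreover have "map_pmf g (map_pmf (\<lambda>x. restrict x \<alpha>) p) = map_pmf (\<lambda>x. restrict x \<alpha>) q"
      by (auto simp: q_def g_def map_pmf_comp restrict_def intro!: map_pmf_cong)
    ultimately show ?thesis
      by simp
  qed
  then have "entropic_vector p = entropic_vector q"
    by (simp add: entropic_vector_def)
  moreover have "finite (set_pmf q)"
    using assms by (simp add: q_def)
  ultimately show ?thesis
    unfolding entropic_vectors_def by blast
qed

definition almost_entropic_vectors :: "(real ^ ('n::finite set)) set" where
  "almost_entropic_vectors = closure entropic_vectors"

definition has_slack :: "(real ^ ('n::finite set)) set \<Rightarrow> bool" where
  "has_slack C \<longleftrightarrow> (\<exists>h\<in>almost_entropic_vectors. \<forall>c\<in>C. c \<bullet> h > 0)"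

end

theory Submission
  imports Defs
begin

text \<open>
  The almost-entropic vectors form a closed convex cone \<open>K\<close>: independent joint copies add
  entropic vectors, and switching \<open>m\<close> independent copies on with probability \<open>t / m\<close> approximates
  the multiple by \<open>t\<close>, since the entropy of the switch tends to \<open>0\<close>. On \<open>K\<close> the functional
  \<open>h \<mapsto> h([n])\<close> dominates every coordinate, so it is positive on \<open>K - {0}\<close>. If \<open>c + \<epsilon>u\<close>, with \<open>u \<bullet> h = h([n])\<close>, were not in
  the cone generated by the \<open>c\<^sub>i\<close> and the dual of \<open>K\<close>, a separating hyperplane would be a nonzero
  \<open>h \<in> K\<close> (bipolar theorem) satisfying the premises of (i) and \<open>c \<bullet> h + \<epsilon> h([n]) \<le> 0\<close>.
  A slack vector bounds the multipliers uniformly in \<open>\<epsilon>\<close>, so they have a limit point as \<open>\<epsilon> \<rightarrow> 0\<close>.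
\<close>

section \<open>Closed convex cones\<close>

text \<open>A hyperplane strictly separating \<open>h\<close> from \<open>K\<close> can be moved to
  the origin. Its offset \<open>b\<close> is negative because 0 lies in \<open>K\<close>, and a
  point of \<open>K\<close> with a negative value could be scaled to have value exactly
  \<open>b\<close>. So the normal \<open>a\<close> is nonnegative on \<open>K\<close> and negative
  at \<open>h\<close>.\<close>

lemma convex_cone_bipolar:
  fixes K :: "'a::euclidean_space set"
  assumes "convex_cone K" "closed K"
    and h: "\<And>a. (\<And>x. x \<in> K \<Longrightarrow> a \<bullet> x \<ge> 0) \<Longrightarrow> a \<bullet> h \<ge> 0"
  shows "h \<in> K"
proof (rule ccontr)
  assume "h \<notin> K"
  moreover have "convex K" "0 \<in> K"
    using assms(1) by (auto simp: convex_cone_def convex_cone_contains_0)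
  ultimately obtain a b where ab: "a \<bullet> h < b" "\<And>x. x \<in> K \<Longrightarrow> b < a \<bullet> x"
    using separating_hyperplane_closed_point[of K h] assms(2) by blast
  have "b < 0"
    using ab(2)[OF \<open>0 \<in> K\<close>] by simp
  have "a \<bullet> x \<ge> 0" if "x \<in> K" for x
  proof (rule ccontr)
    assume neg: "\<not> a \<bullet> x \<ge> 0"
    then have "(b / (a \<bullet> x)) *\<^sub>R x \<in> K"
      using assms(1) \<open>b < 0\<close> that by (intro convex_cone_scaleR) (auto simp: divide_nonpos_nonpos)
    from ab(2)[OF this] neg show False
      by simp
  qed
  then have "a \<bullet> h \<ge> 0"
    by (rule h)
  with ab(1) \<open>b < 0\<close> show False
    by simp
qed

text \<open>A sum of closed cones need not be closed, so only weak separation from it is available.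
  The term with \<epsilon> compensates: positivity of \<open>u\<close> on nonzero points of
  \<open>K\<close> makes the decisive inequality strict.\<close>

lemma conic_farkas_approx:
  fixes K :: "'a::euclidean_space set" and d :: "'i \<Rightarrow> 'a"
  assumes K: "convex_cone K" "closed K" and "finite I"
    and u: "\<And>h. h \<in> K \<Longrightarrow> h \<noteq> 0 \<Longrightarrow> u \<bullet> h > 0"
    and impl: "\<And>h. h \<in> K \<Longrightarrow> (\<forall>i\<in>I. d i \<bullet> h \<ge> 0) \<Longrightarrow> c \<bullet> h \<ge> 0"
    and "\<epsilon> > 0"
  shows "\<exists>l. (\<forall>i\<in>I. l i \<ge> 0) \<and> (\<forall>h\<in>K. c \<bullet> h + \<epsilon> * (u \<bullet> h) \<ge> (\<Sum>i\<in>I. l i * (d i \<bullet> h)))"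
proof -
  \<comment> \<open>The sum of the dual cone of \<open>K\<close> and the cone spanned by the
    \<open>d i\<close>, written so that the goal becomes
    \<open>c + \<epsilon> *\<^sub>R u \<in> A\<close>.\<close>
  define A where "A = {a. \<exists>l. (\<forall>i\<in>I. l i \<ge> 0) \<and> (\<forall>h\<in>K. a \<bullet> h \<ge> (\<Sum>i\<in>I. l i * (d i \<bullet> h)))}"
  have A_I: "a \<in> A" if "\<And>i. i \<in> I \<Longrightarrow> l i \<ge> 0"
    "\<And>h. h \<in> K \<Longrightarrow> a \<bullet> h \<ge> (\<Sum>i\<in>I. l i * (d i \<bullet> h))" for a l
    using that unfolding A_def by blast
  have dual: "a \<in> A" if "\<And>h. h \<in> K \<Longrightarrow> a \<bullet> h \<ge> 0" for a
    using that by (intro A_I[of "\<lambda>_. 0"]) auto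
  have "convex_cone A"
    unfolding convex_cone_iff
  proof (intro conjI ballI allI impI)
    show "0 \<in> A"
      by (rule dual) simp
  next
    fix a b assume "a \<in> A" "b \<in> A"
    then obtain l m where "\<And>i. i \<in> I \<Longrightarrow> l i \<ge> 0" "\<And>i. i \<in> I \<Longrightarrow> m i \<ge> 0"
      and "\<And>h. h \<in> K \<Longrightarrow> a \<bullet> h \<ge> (\<Sum>i\<in>I. l i * (d i \<bullet> h))"
      and "\<And>h. h \<in> K \<Longrightarrow> b \<bullet> h \<ge> (\<Sum>i\<in>I. m i * (d i \<bullet> h))"
      unfolding A_def by blast
    then show "a + b \<in> A"
      by (intro A_I[of "\<lambda>i. l i + m i"]) (auto simp: inner_add_left distrib_right sum.distrib add_mono)
  next
    fix a and t :: real assume "a \<in> A" "t \<ge> 0"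
    then obtain l where "\<And>i. i \<in> I \<Longrightarrow> l i \<ge> 0"
      and "\<And>h. h \<in> K \<Longrightarrow> a \<bullet> h \<ge> (\<Sum>i\<in>I. l i * (d i \<bullet> h))"
      unfolding A_def by auto
    with \<open>t \<ge> 0\<close> show "t *\<^sub>R a \<in> A"
      by (intro A_I[of "\<lambda>i. t * l i"]) (auto simp: mult.assoc mult_left_mono simp flip: sum_distrib_left)
  qed
  have d: "d j \<in> A" if "j \<in> I" for j
  proof (rule A_I)
    fix h
    have "(\<Sum>i\<in>I. of_bool (i = j) * (d i \<bullet> h)) = d j \<bullet> h"
      using that \<open>finite I\<close> by (subst sum.remove[of I j]) auto
    then show "(\<Sum>i\<in>I. of_bool (i = j) * (d i \<bullet> h)) \<le> d j \<bullet> h"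
      by simp
  qed simp
  have "c + \<epsilon> *\<^sub>R u \<in> A"
  proof (rule ccontr)
    assume "c + \<epsilon> *\<^sub>R u \<notin> A"
    then obtain h b where "h \<noteq> 0" and b: "h \<bullet> (c + \<epsilon> *\<^sub>R u) \<le> b" "\<And>a. a \<in> A \<Longrightarrow> h \<bullet> a \<ge> b"
      using separating_hyperplane_sets[of "{c + \<epsilon> *\<^sub>R u}" A] \<open>convex_cone A\<close>
      by (auto simp: convex_cone_def)
    have "b \<le> 0"
      using b(2)[OF convex_cone_contains_0] \<open>convex_cone A\<close> by simp
    have nonneg: "a \<bullet> h \<ge> 0" if "a \<in> A" for a
    proof (rule ccontr)
      assume neg: "\<not> a \<bullet> h \<ge> 0"
      \<comment> \<open>The scaled point has inner product \<open>b - 1\<close> with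
        \<open>h\<close>, which violates the bound even if \<open>b = 0\<close>.\<close>
      then have "((b - 1) / (a \<bullet> h)) *\<^sub>R a \<in> A"
        using \<open>convex_cone A\<close> \<open>b \<le> 0\<close> that by (intro convex_cone_scaleR) (auto simp: divide_nonpos_nonpos)
      from b(2)[OF this] neg show False
        by (simp add: inner_commute[of h])
    qed
    \<comment> \<open>Zero multipliers put the whole dual cone of \<open>K\<close> into
      \<open>A\<close>, so \<open>h\<close> lies in the bidual. The generators \<open>d i\<close>
      are in \<open>A\<close> too, which gives the premises of \<open>impl\<close>.\<close>
    have "h \<in> K"
      using K by (rule convex_cone_bipolar) (simp add: nonneg dual)
    then have "c \<bullet> h \<ge> 0" "u \<bullet> h > 0"
      using impl[of h] u[of h] nonneg d \<open>h \<noteq> 0\<close> by auto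
    then show False
      using b(1) \<open>b \<le> 0\<close> mult_pos_pos[OF \<open>\<epsilon> > 0\<close> \<open>u \<bullet> h > 0\<close>]
      by (simp add: inner_add_right inner_commute[of h])
  qed
  then show ?thesis
    by (simp add: A_def inner_add_left)
qed

section \<open>Limits of bounded multipliers\<close>

lemma bounded_family_convergent_subseq:
  fixes f :: "nat \<Rightarrow> 'i \<Rightarrow> real"
  assumes "finite I" "\<And>i. i \<in> I \<Longrightarrow> bounded (range (\<lambda>n. f n i))"
  shows "\<exists>l r. strict_mono r \<and> (\<forall>i\<in>I. (\<lambda>n. f (r n) i) \<longlonglongrightarrow> l i)"
proof -
  have "\<forall>J\<subseteq>I. \<exists>l r. strict_mono r \<and>
      (\<forall>\<epsilon>>0. eventually (\<lambda>n. \<forall>i\<in>J. dist (f (r n) i) (l i) < \<epsilon>) sequentially)"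
    by (rule compact_lemma_general[where unproj = "\<lambda>x. x"]) (use assms in \<open>auto simp: image_image\<close>)
  then obtain l r where "strict_mono r"
    and "\<And>\<epsilon>. \<epsilon> > 0 \<Longrightarrow> eventually (\<lambda>n. \<forall>i\<in>I. dist (f (r n) i) (l i) < \<epsilon>) sequentially"
    by blast
  then have "\<forall>i\<in>I. (\<lambda>n. f (r n) i) \<longlonglongrightarrow> l i"
    unfolding tendsto_iff by (blast intro: eventually_mono)
  with \<open>strict_mono r\<close> show ?thesis
    by blast
qed

lemma conic_multipliers_limit:
  fixes K :: "'a::real_inner set" and d :: "'i \<Rightarrow> 'a"
  assumes "finite I" "h\<^sub>0 \<in> K" and slack: "\<And>i. i \<in> I \<Longrightarrow> d i \<bullet> h\<^sub>0 > 0"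
    and approx: "\<And>\<epsilon>. \<epsilon> > 0 \<Longrightarrow> \<exists>l. (\<forall>i\<in>I. l i \<ge> 0) \<and>
      (\<forall>h\<in>K. c \<bullet> h + \<epsilon> * (u \<bullet> h) \<ge> (\<Sum>i\<in>I. l i * (d i \<bullet> h)))"
  shows "\<exists>l. (\<forall>i\<in>I. l i \<ge> 0) \<and> (\<forall>h\<in>K. c \<bullet> h \<ge> (\<Sum>i\<in>I. l i * (d i \<bullet> h)))"
proof -
  have "\<forall>n. \<exists>l. (\<forall>i\<in>I. l i \<ge> 0) \<and>
      (\<forall>h\<in>K. c \<bullet> h + inverse (real (Suc n)) * (u \<bullet> h) \<ge> (\<Sum>i\<in>I. l i * (d i \<bullet> h)))"
    using approx by simp
  then obtain f where nonneg: "\<And>n i. i \<in> I \<Longrightarrow> f n i \<ge> 0"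
    and f: "\<And>n h. h \<in> K \<Longrightarrow>
      c \<bullet> h + inverse (real (Suc n)) * (u \<bullet> h) \<ge> (\<Sum>i\<in>I. f n i * (d i \<bullet> h))"
    by metis
  have bdd: "bounded (range (\<lambda>n. f n j))" if "j \<in> I" for j
  proof (rule boundedI)
    fix x assume "x \<in> range (\<lambda>n. f n j)"
    then obtain n where x: "x = f n j"
      by blast
    \<comment> \<open>At the slack vector no summand is negative, so a single one is at most the
      whole sum. Dividing by \<open>d j \<bullet> h\<^sub>0 > 0\<close> then bounds the
      multiplier.\<close>
    have "f n j * (d j \<bullet> h\<^sub>0) \<le> (\<Sum>i\<in>I. f n i * (d i \<bullet> h\<^sub>0))"
      using \<open>finite I\<close> that nonneg slack
      by (intro member_le_sum mult_nonneg_nonneg) (auto intro: less_imp_le)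
    also have "\<dots> \<le> c \<bullet> h\<^sub>0 + inverse (real (Suc n)) * (u \<bullet> h\<^sub>0)"
      using f \<open>h\<^sub>0 \<in> K\<close> .
    \<comment> \<open>The sign of \<open>u \<bullet> h\<^sub>0\<close> is unknown here; the absolute
      value allows the factor, at most 1, to be replaced by 1.\<close>
    also have "inverse (real (Suc n)) * (u \<bullet> h\<^sub>0) \<le> inverse (real (Suc n)) * \<bar>u \<bullet> h\<^sub>0\<bar>"
      by (intro mult_left_mono) auto
    also have "\<dots> \<le> 1 * \<bar>u \<bullet> h\<^sub>0\<bar>"
      by (intro mult_right_mono) (auto simp: field_simps)
    finally have "f n j \<le> (c \<bullet> h\<^sub>0 + \<bar>u \<bullet> h\<^sub>0\<bar>) / (d j \<bullet> h\<^sub>0)"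
      using slack[OF that] by (simp add: field_simps)
    then show "norm x \<le> (c \<bullet> h\<^sub>0 + \<bar>u \<bullet> h\<^sub>0\<bar>) / (d j \<bullet> h\<^sub>0)"
      using nonneg[OF that] by (simp add: x)
  qed
  obtain l r where "strict_mono r" and lim: "\<And>i. i \<in> I \<Longrightarrow> (\<lambda>n. f (r n) i) \<longlonglongrightarrow> l i"
    using bounded_family_convergent_subseq[OF \<open>finite I\<close>, of f] bdd by blast
  have "l i \<ge> 0" if "i \<in> I" for i
    using lim[OF that] by (rule LIMSEQ_le_const) (use nonneg[OF that] in auto)
  moreover have "c \<bullet> h \<ge> (\<Sum>i\<in>I. l i * (d i \<bullet> h))" if "h \<in> K" for h
  proof (rule LIMSEQ_le)
    show "(\<lambda>n. \<Sum>i\<in>I. f (r n) i * (d i \<bullet> h)) \<longlonglongrightarrow> (\<Sum>i\<in>I. l i * (d i \<bullet> h))"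
      by (intro tendsto_intros lim)
    have "(\<lambda>n. inverse (real (Suc (r n)))) \<longlonglongrightarrow> 0"
      using LIMSEQ_subseq_LIMSEQ[OF LIMSEQ_inverse_real_of_nat \<open>strict_mono r\<close>] by (simp add: o_def)
    then have "(\<lambda>n. c \<bullet> h + inverse (real (Suc (r n))) * (u \<bullet> h)) \<longlonglongrightarrow> c \<bullet> h + 0 * (u \<bullet> h)"
      by (intro tendsto_intros)
    then show "(\<lambda>n. c \<bullet> h + inverse (real (Suc (r n))) * (u \<bullet> h)) \<longlonglongrightarrow> c \<bullet> h"
      by simp
    show "\<exists>N. \<forall>n\<ge>N. (\<Sum>i\<in>I. f (r n) i * (d i \<bullet> h)) \<le> c \<bullet> h + inverse (real (Suc (r n))) * (u \<bullet> h)"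
      using f[OF that] by blast
  qed
  ultimately show ?thesis
    by blast
qed

section \<open>Shannon entropy\<close>

lemma shannon_entropy_return_pmf [simp]: "shannon_entropy (return_pmf x) = 0"
  by (simp add: shannon_entropy_def)

lemma shannon_entropy_nonneg: "shannon_entropy p \<ge> 0"
proof -
  have "pmf p x * log 2 (pmf p x) \<le> 0" if "x \<in> set_pmf p" for x
    using that by (intro mult_nonneg_nonpos) (auto simp: pmf_positive pmf_le_1)
  then show ?thesis
    unfolding shannon_entropy_def by (simp add: sum_nonpos)
qed

text \<open>Both sides are the expectation of \<open>g\<close> under the image distribution. Moving
  the sum to the original support permits termwise comparison there.\<close>

lemma sum_map_pmf_eq:
  fixes g :: "'b \<Rightarrow> real"
  assumes "finite (set_pmf p)"
  shows "(\<Sum>y\<in>set_pmf (map_pmf f p). pmf (map_pmf f p) y * g y) = (\<Sum>x\<in>set_pmf p. pmf p x * g (f x))"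
proof -
  have "(\<Sum>y\<in>set_pmf (map_pmf f p). pmf (map_pmf f p) y * g y) = measure_pmf.expectation (map_pmf f p) g"
    by (subst integral_measure_pmf[of "set_pmf (map_pmf f p)"]) (use assms in auto)
  also have "\<dots> = measure_pmf.expectation p (\<lambda>x. g (f x))"
    by simp
  also have "\<dots> = (\<Sum>x\<in>set_pmf p. pmf p x * g (f x))"
    by (subst integral_measure_pmf[of "set_pmf p"]) (use assms in auto)
  finally show ?thesis .
qed

text \<open>Merging outcomes cannot lower a probability: the fibre over \<open>f x\<close> contains
  \<open>x\<close>. Applied to restrictions, this makes the joint entropy dominate every
  coordinate.\<close>

lemma shannon_entropy_map_le:
  assumes "finite (set_pmf p)"
  shows "shannon_entropy (map_pmf f p) \<le> shannon_entropy p"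
proof -
  have "pmf p x \<le> pmf (map_pmf f p) (f x)" for x
    unfolding pmf_map pmf.rep_eq[of p] by (intro measure_pmf.finite_measure_mono) auto
  then have "pmf p x * log 2 (pmf p x) \<le> pmf p x * log 2 (pmf (map_pmf f p) (f x))"
    if "x \<in> set_pmf p" for x
    using that pmf_positive[OF that] by (intro mult_left_mono log_mono) auto
  then show ?thesis
    unfolding shannon_entropy_def sum_map_pmf_eq[OF assms, of f "\<lambda>y. log 2 (pmf (map_pmf f p) y)"]
    by (simp add: sum_mono)
qed

text \<open>The logarithm of the product probability splits into two terms, each of which depends on
  one component only and so averages over the corresponding marginal.\<close>

lemma shannon_entropy_pair_pmf:
  assumes "finite (set_pmf p)" "finite (set_pmf q)"
  shows "shannon_entropy (pair_pmf p q) = shannon_entropy p + shannon_entropy q"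
proof -
  let ?r = "pair_pmf p q"
  have fin: "finite (set_pmf ?r)"
    using assms by simp
  have "(\<Sum>z\<in>set_pmf ?r. pmf ?r z * log 2 (pmf ?r z)) =
      (\<Sum>z\<in>set_pmf ?r. pmf ?r z * log 2 (pmf p (fst z)) + pmf ?r z * log 2 (pmf q (snd z)))"
    by (rule sum.cong) (auto simp: pmf_pair log_mult pmf_positive algebra_simps pmf_eq_0_set_pmf)
  also have "\<dots> = (\<Sum>x\<in>set_pmf p. pmf p x * log 2 (pmf p x)) + (\<Sum>y\<in>set_pmf q. pmf q y * log 2 (pmf q y))"
    using sum_map_pmf_eq[OF fin, of fst "\<lambda>x. log 2 (pmf p x)"]
      sum_map_pmf_eq[OF fin, of snd "\<lambda>y. log 2 (pmf q y)"]
    by (simp add: sum.distrib map_fst_pair_pmf map_snd_pair_pmf del: set_map_pmf set_pair_pmf)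
  finally show ?thesis
    by (simp add: shannon_entropy_def)
qed

section \<open>Mixtures over a random switch\<close>

definition mixture_pmf :: "real \<Rightarrow> 'a pmf \<Rightarrow> 'a pmf \<Rightarrow> 'a pmf" where
  "mixture_pmf \<delta> p q = bind_pmf (bernoulli_pmf \<delta>) (\<lambda>b. if b then p else q)"

lemma map_mixture_pmf: "map_pmf f (mixture_pmf \<delta> p q) = mixture_pmf \<delta> (map_pmf f p) (map_pmf f q)"
  unfolding mixture_pmf_def map_bind_pmf by (intro bind_pmf_cong) auto

lemma set_mixture_pmf: "0 < \<delta> \<Longrightarrow> \<delta> < 1 \<Longrightarrow> set_pmf (mixture_pmf \<delta> p q) = set_pmf p \<union> set_pmf q"
  unfolding mixture_pmf_def by (auto simp: set_pmf_bernoulli UNIV_bool)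

lemma pmf_mixture_pmf:
  "0 < \<delta> \<Longrightarrow> \<delta> < 1 \<Longrightarrow> pmf (mixture_pmf \<delta> p q) x = \<delta> * pmf p x + (1 - \<delta>) * pmf q x"
  unfolding mixture_pmf_def by (simp add: pmf_bind)

text \<open>Disjoint supports make the switch a function of the outcome, whence the exact formula.\<close>

lemma shannon_entropy_mixture_pmf:
  assumes "0 < \<delta>" "\<delta> < 1" and fin: "finite (set_pmf p)" "finite (set_pmf q)"
    and disj: "set_pmf p \<inter> set_pmf q = {}"
  shows "shannon_entropy (mixture_pmf \<delta> p q) =
    \<delta> * shannon_entropy p + (1 - \<delta>) * shannon_entropy q - \<delta> * log 2 \<delta> - (1 - \<delta>) * log 2 (1 - \<delta>)"
proof -
  let ?m = "mixture_pmf \<delta> p q"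
  \<comment> \<open>The contribution of one component \<open>r\<close> of weight \<open>t\<close>.
    It serves for \<open>p\<close> with weight \<delta> and for \<open>q\<close> with weight
    \<open>1 - \<delta>\<close>, since on either support the other pmf vanishes.\<close>
  have part: "(\<Sum>x\<in>set_pmf r. pmf ?m x * log 2 (pmf ?m x)) = t * log 2 t - t * shannon_entropy r"
    if r: "finite (set_pmf r)" "t > 0" "\<And>x. x \<in> set_pmf r \<Longrightarrow> pmf ?m x = t * pmf r x" for r t
  proof -
    have "(\<Sum>x\<in>set_pmf r. pmf ?m x * log 2 (pmf ?m x)) =
        (\<Sum>x\<in>set_pmf r. (t * log 2 t) * pmf r x + t * (pmf r x * log 2 (pmf r x)))"
    proof (rule sum.cong)
      fix x assume "x \<in> set_pmf r"
      then have "pmf r x > 0"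
        by (rule pmf_positive)
      then show "pmf ?m x * log 2 (pmf ?m x) = (t * log 2 t) * pmf r x + t * (pmf r x * log 2 (pmf r x))"
        using r \<open>x \<in> set_pmf r\<close> by (simp add: log_mult algebra_simps)
    qed simp
    also have "\<dots> = t * log 2 t * (\<Sum>x\<in>set_pmf r. pmf r x) - t * shannon_entropy r"
      by (simp add: sum.distrib shannon_entropy_def flip: sum_distrib_left)
    finally show ?thesis
      using r by (simp add: sum_pmf_eq_1)
  qed
  have "pmf q x = 0" if "x \<in> set_pmf p" for x
    using disj that by (auto simp: pmf_eq_0_set_pmf)
  moreover have "pmf p x = 0" if "x \<in> set_pmf q" for x
    using disj that by (auto simp: pmf_eq_0_set_pmf)
  ultimately show ?thesis
    using assms part[of p \<delta>] part[of q "1 - \<delta>"]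
    by (simp add: shannon_entropy_def[of ?m] set_mixture_pmf pmf_mixture_pmf sum.union_disjoint)
qed

section \<open>The cone of almost-entropic vectors\<close>

text \<open>Independent tuples are paired coordinate by coordinate. Every marginal of the result is
  an injective relabelling of the product of the two marginals, where entropy is additive.\<close>

lemma entropic_vectors_add:
  fixes g h :: "real ^ ('n::finite set)"
  assumes "g \<in> entropic_vectors" "h \<in> entropic_vectors"
  shows "g + h \<in> entropic_vectors"
proof -
  obtain p q :: "('n \<Rightarrow> nat) pmf" where fin: "finite (set_pmf p)" "finite (set_pmf q)"
    and gh: "g = entropic_vector p" "h = entropic_vector q"
    using assms by (auto simp: entropic_vectors_def)
  define r :: "('n \<Rightarrow> nat \<times> nat) pmf" where "r = map_pmf (\<lambda>(x, y) i. (x i, y i)) (pair_pmf p q)"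
  have "shannon_entropy (map_pmf (\<lambda>z. restrict z \<alpha>) r) =
      shannon_entropy (map_pmf (\<lambda>x. restrict x \<alpha>) p) + shannon_entropy (map_pmf (\<lambda>x. restrict x \<alpha>) q)"
    for \<alpha> :: "'n set"
  proof -
    let ?R = "\<lambda>x. restrict x \<alpha>"
    let ?s = "pair_pmf (map_pmf ?R p) (map_pmf ?R q)"
    let ?J = "\<lambda>(x, y). \<lambda>i\<in>\<alpha>. (x i, y i)"
    have "map_pmf (\<lambda>z. restrict z \<alpha>) r = map_pmf ?J ?s"
      unfolding r_def map_pair[symmetric] map_pmf_comp
      by (intro map_pmf_cong) (auto simp: fun_eq_iff restrict_def)
    \<comment> \<open>\<open>?J\<close> forgets all values outside \<alpha>, but on the support of
      \<open>?s\<close> both tuples are \<open>undefined\<close> there.\<close>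
    moreover have "inj_on ?J (set_pmf ?s)"
    proof (rule inj_onI)
      fix v w assume "v \<in> set_pmf ?s" "w \<in> set_pmf ?s" and eq: "?J v = ?J w"
      then obtain x y x' y' where vw: "v = (restrict x \<alpha>, restrict y \<alpha>)" "w = (restrict x' \<alpha>, restrict y' \<alpha>)"
        by auto
      have "x i = x' i \<and> y i = y' i" if "i \<in> \<alpha>" for i
        using fun_cong[OF eq, of i] that by (simp add: vw)
      then show "v = w"
        by (auto simp: vw fun_eq_iff restrict_def)
    qed
    ultimately show ?thesis
      using fin by (simp add: shannon_entropy_map_inj shannon_entropy_pair_pmf)
  qed
  then have "g + h = entropic_vector r"
    by (simp add: gh entropic_vector_def vec_eq_iff)
  moreover have "finite (set_pmf r)"
    using fin by (simp add: r_def)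
  ultimately show ?thesis
    by (simp add: entropic_vector_in_entropic_vectors)
qed

lemma zero_in_entropic_vectors: "(0 :: real ^ ('n::finite set)) \<in> entropic_vectors"
proof -
  have "entropic_vector (return_pmf (\<lambda>_. 0 :: nat)) = (0 :: real ^ ('n set))"
    by (simp add: entropic_vector_def vec_eq_iff)
  then show ?thesis
    using entropic_vector_in_entropic_vectors[of "return_pmf (\<lambda>_::'n. 0 :: nat)"] by simp
qed

lemma entropic_vectors_of_nat_scaleR:
  "h \<in> entropic_vectors \<Longrightarrow> real m *\<^sub>R h \<in> entropic_vectors"
  by (induction m) (auto simp: zero_in_entropic_vectors entropic_vectors_add scaleR_left_distrib)

text \<open>The tuple is kept with probability \<delta> and otherwise replaced by the fresh symbol
  \<open>None\<close> in every coordinate. Any nonempty subtuple reveals the switch and so gains its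
  binary entropy; the empty one reveals nothing, hence the case distinction.\<close>

lemma entropic_vectors_mixture:
  fixes h :: "real ^ ('n::finite set)"
  assumes "h \<in> entropic_vectors" "0 < \<delta>" "\<delta> < 1"
  shows "\<delta> *\<^sub>R h + (\<chi> \<alpha>. if \<alpha> = {} then 0 else - \<delta> * log 2 \<delta> - (1 - \<delta>) * log 2 (1 - \<delta>)) \<in> entropic_vectors"
proof -
  obtain p :: "('n \<Rightarrow> nat) pmf" where fin: "finite (set_pmf p)" and h: "h = entropic_vector p"
    using assms by (auto simp: entropic_vectors_def)
  define r :: "('n \<Rightarrow> nat option) pmf"
    where "r = mixture_pmf \<delta> (map_pmf (\<lambda>x i. Some (x i)) p) (return_pmf (\<lambda>_. None))"
  have finr: "finite (set_pmf r)"
    using assms fin by (simp add: r_def set_mixture_pmf)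
  have marginal: "shannon_entropy (map_pmf (\<lambda>z. restrict z \<alpha>) r) =
      \<delta> * shannon_entropy (map_pmf (\<lambda>x. restrict x \<alpha>) p) - \<delta> * log 2 \<delta> - (1 - \<delta>) * log 2 (1 - \<delta>)"
    if "\<alpha> \<noteq> {}" for \<alpha>
  proof -
    obtain j where "j \<in> \<alpha>"
      using \<open>\<alpha> \<noteq> {}\<close> by blast
    let ?S = "\<lambda>x. \<lambda>i\<in>\<alpha>. Some (x i)"
    let ?q = "map_pmf ?S (map_pmf (\<lambda>x. restrict x \<alpha>) p)"
    have "map_pmf (\<lambda>z. restrict z \<alpha>) (map_pmf (\<lambda>x i. Some (x i)) p) = ?q"
      unfolding map_pmf_comp by (intro map_pmf_cong) (auto simp: fun_eq_iff restrict_def)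
    then have "map_pmf (\<lambda>z. restrict z \<alpha>) r = mixture_pmf \<delta> ?q (return_pmf (\<lambda>i\<in>\<alpha>. None))"
      by (simp add: r_def map_mixture_pmf)
    moreover have "set_pmf ?q \<inter> set_pmf (return_pmf (\<lambda>i\<in>\<alpha>. None)) = {}"
      using \<open>j \<in> \<alpha>\<close> by (auto dest: fun_cong[of _ _ j])
    moreover have "shannon_entropy ?q = shannon_entropy (map_pmf (\<lambda>x. restrict x \<alpha>) p)"
    proof (rule shannon_entropy_map_inj, rule inj_onI)
      fix v w assume "v \<in> set_pmf (map_pmf (\<lambda>x. restrict x \<alpha>) p)"
        "w \<in> set_pmf (map_pmf (\<lambda>x. restrict x \<alpha>) p)" and eq: "?S v = ?S w"
      then obtain x y where vw: "v = restrict x \<alpha>" "w = restrict y \<alpha>"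
        by auto
      have "x i = y i" if "i \<in> \<alpha>" for i
        using fun_cong[OF eq, of i] that by (simp add: vw)
      then show "v = w"
        by (auto simp: vw fun_eq_iff restrict_def)
    qed
    ultimately show ?thesis
      using shannon_entropy_mixture_pmf[OF assms(2,3), of ?q "return_pmf (\<lambda>i\<in>\<alpha>. None)"] fin by simp
  qed
  have "entropic_vector r =
      \<delta> *\<^sub>R h + (\<chi> \<alpha>. if \<alpha> = {} then 0 else - \<delta> * log 2 \<delta> - (1 - \<delta>) * log 2 (1 - \<delta>))"
  proof (rule vec_eq_iff[THEN iffD2, rule_format])
    fix \<alpha>
    show "entropic_vector r $ \<alpha> =
      (\<delta> *\<^sub>R h + (\<chi> \<alpha>. if \<alpha> = {} then 0 else - \<delta> * log 2 \<delta> - (1 - \<delta>) * log 2 (1 - \<delta>))) $ \<alpha>"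
      using marginal[of \<alpha>] by (cases "\<alpha> = {}") (simp_all add: h entropic_vector_empty, simp add: entropic_vector_def)
  qed
  with entropic_vector_in_entropic_vectors[OF finr] show ?thesis
    by simp
qed

text \<open>With \<open>m\<close> copies and switch probability \<open>t / m\<close>, the main term
  is exactly \<open>t *\<^sub>R h\<close>. The error is the binary entropy \<open>b (t / m)\<close>
  in each nonempty coordinate, whatever \<open>h\<close> is, and tends to 0.\<close>

lemma entropic_vectors_scaleR:
  fixes h :: "real ^ ('n::finite set)"
  assumes "h \<in> entropic_vectors" "t \<ge> 0"
  shows "t *\<^sub>R h \<in> almost_entropic_vectors"
proof (cases "t = 0")
  case True
  then show ?thesis
    using zero_in_entropic_vectors closure_subset by (auto simp: almost_entropic_vectors_def)
next
  case False
  with assms have "t > 0"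
    by simp
  define b :: "real \<Rightarrow> real" where "b \<delta> = - \<delta> * log 2 \<delta> - (1 - \<delta>) * log 2 (1 - \<delta>)" for \<delta>
  define w :: "nat \<Rightarrow> real ^ ('n set)" where "w m = (\<chi> \<alpha>. if \<alpha> = {} then 0 else b (t / real m))" for m
  have lim: "(\<lambda>m. b (t / real m)) \<longlonglongrightarrow> 0"
    unfolding b_def log_def using \<open>t > 0\<close> by real_asymp
  have "(\<lambda>m. if \<alpha> = {} then 0 else b (t / real m)) \<longlonglongrightarrow> 0" for \<alpha> :: "'n set"
    using lim by (cases "\<alpha> = {}") auto
  then have "w \<longlonglongrightarrow> 0"
    by (intro vec_tendstoI) (simp add: w_def)
  then have "(\<lambda>m. t *\<^sub>R h + w m) \<longlonglongrightarrow> t *\<^sub>R h + 0"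
    by (intro tendsto_intros)
  \<comment> \<open>Only large \<open>m\<close> qualify, since the switch probability
    \<open>t / m\<close> must be below 1.\<close>
  moreover have "eventually (\<lambda>m. t *\<^sub>R h + w m \<in> entropic_vectors) sequentially"
    using eventually_gt_at_top[of "nat \<lceil>t\<rceil>"]
  proof eventually_elim
    case (elim m)
    then have "real m > t"
      by linarith
    with \<open>t > 0\<close> have "0 < t / real m" "t / real m < 1" "(t / real m) *\<^sub>R (real m *\<^sub>R h) = t *\<^sub>R h"
      by auto
    with entropic_vectors_mixture[OF entropic_vectors_of_nat_scaleR[OF assms(1), of m], of "t / real m"]
    show ?case
      by (simp only: w_def b_def)
  qed
  ultimately show ?thesis
    unfolding almost_entropic_vectors_def
    by (intro Lim_in_closed_set[of _ _ sequentially])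
      (auto elim: eventually_mono intro: closure_subset[THEN subsetD])
qed

lemma convex_cone_almost_entropic_vectors:
  "convex_cone (almost_entropic_vectors :: (real ^ ('n::finite set)) set)"
  unfolding convex_cone_iff
proof (intro conjI ballI allI impI)
  let ?E = "entropic_vectors :: (real ^ ('n set)) set"
  show "0 \<in> (almost_entropic_vectors :: (real ^ ('n set)) set)"
    using zero_in_entropic_vectors closure_subset by (auto simp: almost_entropic_vectors_def)
  show "g + h \<in> almost_entropic_vectors"
    if "g \<in> almost_entropic_vectors" "h \<in> almost_entropic_vectors" for g h :: "real ^ ('n set)"
  proof -
    have "g + h \<in> closure (?E + ?E)"
      using closure_sum[of ?E ?E] that by (auto simp: almost_entropic_vectors_def)
    moreover have "?E + ?E \<subseteq> ?E"
      by (auto elim!: set_plus_elim intro: entropic_vectors_add)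
    ultimately show ?thesis
      unfolding almost_entropic_vectors_def using closure_mono by blast
  qed
  show "t *\<^sub>R h \<in> almost_entropic_vectors"
    if "h \<in> almost_entropic_vectors" "t \<ge> 0" for h :: "real ^ ('n set)" and t
  proof -
    \<comment> \<open>Scaling commutes with closure, but scaled entropic vectors are only known to
      be almost entropic; minimality of the closure absorbs this second limit.\<close>
    have "t *\<^sub>R h \<in> closure ((*\<^sub>R) t ` ?E)"
      using that by (auto simp: almost_entropic_vectors_def simp flip: closure_scaleR)
    moreover have "(*\<^sub>R) t ` ?E \<subseteq> closure ?E"
      using entropic_vectors_scaleR that(2) by (auto simp: almost_entropic_vectors_def)
    ultimately show ?thesis
      unfolding almost_entropic_vectors_def using closure_minimal[OF _ closed_closure] by blast
  qed
qed

section \<open>Domination by the joint entropy\<close>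

lemma almost_entropic_vector_bounds:
  fixes h :: "real ^ ('n::finite set)"
  assumes "h \<in> almost_entropic_vectors"
  shows "0 \<le> h $ \<alpha>" "h $ \<alpha> \<le> h $ UNIV"
proof -
  let ?B = "{h :: real ^ ('n set). 0 \<le> h $ \<alpha>} \<inter> {h. h $ \<alpha> \<le> h $ UNIV}"
  \<comment> \<open>Both bounds are closed conditions, so it suffices to check them for genuine
    entropies.\<close>
  have "entropic_vectors \<subseteq> ?B"
    by (auto simp: entropic_vectors_def entropic_vector_def shannon_entropy_nonneg
        shannon_entropy_map_le restrict_UNIV)
  moreover have "closed ?B"
    by (intro closed_Int closed_Collect_le continuous_intros)
  ultimately have "almost_entropic_vectors \<subseteq> ?B"
    unfolding almost_entropic_vectors_def by (rule closure_minimal)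
  with assms show "0 \<le> h $ \<alpha>" "h $ \<alpha> \<le> h $ UNIV"
    by auto
qed

text \<open>Zero joint entropy would squeeze every coordinate to 0. This supplies the positivity of
  \<open>u\<close> that \<open>conic_farkas_approx\<close> requires.\<close>

lemma almost_entropic_vector_UNIV_pos:
  fixes h :: "real ^ ('n::finite set)"
  assumes "h \<in> almost_entropic_vectors" "h \<noteq> 0"
  shows "h $ UNIV > 0"
proof -
  obtain \<alpha> where "h $ \<alpha> \<noteq> 0"
    using assms(2) by (auto simp: vec_eq_iff)
  with almost_entropic_vector_bounds[OF assms(1), of \<alpha>] show ?thesis
    by simp
qed

theorem corollary10:
  fixes c :: "real ^ ('n::finite set)" and cs :: "nat \<Rightarrow> real ^ ('n set)" and k :: nat
  assumes "k \<ge> 1"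
  shows "((\<forall>h\<in>almost_entropic_vectors. (\<forall>i\<in>{1..k}. cs i \<bullet> h \<ge> 0) \<longrightarrow> c \<bullet> h \<ge> 0) \<longleftrightarrow>
          (\<forall>\<epsilon>>0. \<exists>l :: nat \<Rightarrow> real. (\<forall>i\<in>{1..k}. l i \<ge> 0) \<and>
             (\<forall>h\<in>almost_entropic_vectors. c \<bullet> h + \<epsilon> * h $ UNIV \<ge> (\<Sum>i\<in>{1..k}. l i * (cs i \<bullet> h)))))
       \<and> (has_slack (cs ` {1..k}) \<longrightarrow>
          ((\<forall>h\<in>almost_entropic_vectors. (\<forall>i\<in>{1..k}. cs i \<bullet> h \<ge> 0) \<longrightarrow> c \<bullet> h \<ge> 0) \<longleftrightarrow>
           (\<exists>l :: nat \<Rightarrow> real. (\<forall>i\<in>{1..k}. l i \<ge> 0) \<and>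
             (\<forall>h\<in>almost_entropic_vectors. c \<bullet> h \<ge> (\<Sum>i\<in>{1..k}. l i * (cs i \<bullet> h))))))"
proof -
  let ?K = "almost_entropic_vectors :: (real ^ ('n set)) set"
  \<comment> \<open>The basis vector that reads off the coordinate of the full index set, that is,
    the joint entropy.\<close>
  let ?u = "axis UNIV 1 :: real ^ ('n set)"
  let ?i = "\<forall>h\<in>?K. (\<forall>i\<in>{1..k}. cs i \<bullet> h \<ge> 0) \<longrightarrow> c \<bullet> h \<ge> 0"
  let ?ii = "\<lambda>\<epsilon>. \<exists>l :: nat \<Rightarrow> real. (\<forall>i\<in>{1..k}. l i \<ge> 0) \<and>
    (\<forall>h\<in>?K. c \<bullet> h + \<epsilon> * h $ UNIV \<ge> (\<Sum>i\<in>{1..k}. l i * (cs i \<bullet> h)))"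
  have u: "?u \<bullet> h = h $ UNIV" for h
    by (simp add: inner_axis')
  have K: "convex_cone ?K" "closed ?K"
    by (rule convex_cone_almost_entropic_vectors) (simp add: almost_entropic_vectors_def)
  have approx: "?ii \<epsilon>" if ?i "\<epsilon> > 0" for \<epsilon>
    using conic_farkas_approx[OF K, of "{1..k}" ?u cs c \<epsilon>] that
    by (simp add: u almost_entropic_vector_UNIV_pos)
  \<comment> \<open>Stated for arbitrary \<epsilon>, so that it serves both the limit \<epsilon>
    \<rightarrow> 0 and the slack case \<epsilon> = 0.\<close>
  have exact: "c \<bullet> h + \<epsilon> * h $ UNIV \<ge> 0"
    if ii: "?ii \<epsilon>" and h: "h \<in> ?K" "\<forall>i\<in>{1..k}. cs i \<bullet> h \<ge> 0" for \<epsilon> h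
  proof -
    obtain l where l: "\<forall>i\<in>{1..k}. l i \<ge> 0" "(\<Sum>i\<in>{1..k}. l i * (cs i \<bullet> h)) \<le> c \<bullet> h + \<epsilon> * h $ UNIV"
      using ii h(1) by blast
    have "0 \<le> (\<Sum>i\<in>{1..k}. l i * (cs i \<bullet> h))"
      using l(1) h(2) by (intro sum_nonneg mult_nonneg_nonneg) auto
    with l(2) show ?thesis
      by linarith
  qed
  have "?i" if ii: "\<forall>\<epsilon>>0. ?ii \<epsilon>"
  proof (intro ballI impI)
    fix h assume h: "h \<in> ?K" "\<forall>i\<in>{1..k}. cs i \<bullet> h \<ge> 0"
    \<comment> \<open>The multipliers vary with \<epsilon> without control, but \<open>exact\<close>
      has eliminated them, so for fixed \<open>h\<close> the limit from the right is
      harmless.\<close>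
    have "((\<lambda>\<epsilon>. c \<bullet> h + \<epsilon> * h $ UNIV) \<longlongrightarrow> c \<bullet> h + 0 * h $ UNIV) (at_right 0)"
      by (intro tendsto_intros)
    moreover have "eventually (\<lambda>\<epsilon>. c \<bullet> h + \<epsilon> * h $ UNIV \<ge> 0) (at_right 0)"
      using eventually_at_right_less[of "0::real"]
      by eventually_elim (use ii exact h in blast)
    ultimately show "c \<bullet> h \<ge> 0"
      using tendsto_lowerbound[of "\<lambda>\<epsilon>. c \<bullet> h + \<epsilon> * h $ UNIV" "c \<bullet> h" "at_right 0" 0] by simp
  qed
  moreover have "?ii 0" if "has_slack (cs ` {1..k})" ?i
  proof -
    obtain h\<^sub>0 where "h\<^sub>0 \<in> ?K" "\<And>i. i \<in> {1..k} \<Longrightarrow> cs i \<bullet> h\<^sub>0 > 0"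
      using \<open>has_slack (cs ` {1..k})\<close> unfolding has_slack_def by auto
    then show ?thesis
      using conic_multipliers_limit[of "{1..k}" h\<^sub>0 ?K cs c ?u] approx[OF \<open>?i\<close>] by (simp add: u)
  qed
  moreover have ?i if "?ii 0"
    using exact[OF that] by simp
  ultimately show ?thesis
    using approx by (simp, blast)
qed

end
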